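(* For every integer $m\ge 0$ and every $x>0$, $$G_8^{m-1}(x^2)<R_m(x)<G_4^m(x^2).$$ Moreover these bounds are optimal in $k$ in the following sense. (Upper bound) For each integer $m\ge 0$ and each real $k$ with $0<k<4$, the inequality $R_m(x)<G_k^m(x^2)$ does not hold for all $x>0$. (Lower bound) $8$ is the largest integer $k$ for which $G_k^{m-1}(x^2)<R_m(x)$ holds for all integers $m\ge 0$ and all $x>0$.
   Context: For real $m>-1$ and $x>0$, $V_m(x)=\frac{1}{\Gamma(m+1)}\int_0^\infty \frac{u^m e^{-u}}{\sqrt{x^2+u}}\,du$, and $V_{-1}(x)=\frac1x$. For integers $m\ge 0$, $R_m(x)=\frac{V_m(x)}{V_{m-1}(x)}$ (so $R_0(x)=xV_0(x)$). For real $k>0$, integer $m\ge -1$ and $y>0$, $$G_k^m(y)=\frac{ky}{(k-1)y-m+\sqrt{(y+m)^2+ky}}.$$ *)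

theory Defs
  imports "HOL-Analysis.Analysis"
begin

text \<open>
  Only used for \<open>m \<ge> -1\<close> and \<open>x > 0\<close>. The integral is a Lebesgue integral over the open
  half-line, so that the convention \<open>0 powr m = 0\<close> plays no role.
\<close>

definition V :: "real \<Rightarrow> real \<Rightarrow> real" where
  "V m x = (if m = -1 then 1 / x
            else 1 / Gamma (m + 1) * (LBINT u:{0<..}. u powr m * exp (- u) / sqrt (x\<^sup>2 + u)))"

definition R :: "nat \<Rightarrow> real \<Rightarrow> real" where
  "R m x = V (real m) x / V (real m - 1) x"

text \<open>
  Only used for \<open>k > 0\<close>, \<open>m \<ge> -1\<close> and \<open>y > 0\<close>, where the denominator is positive.
\<close>

definition G :: "real \<Rightarrow> int \<Rightarrow> real \<Rightarrow> real" where
  "G k m y = k * y / ((k - 1) * y - of_int m + sqrt ((y + of_int m)\<^sup>2 + k * y))"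

end

theory Submission
  imports Defs "HOL-Real_Asymp.Real_Asymp"
begin

text \<open>
  Put \<open>y = x\<^sup>2\<close>. An integration by parts gives the three-term recurrence
  \<open>(m + 1) V\<^bsub>m+1\<^esub> = (m + 1/2 - y) V\<^bsub>m\<^esub> + y V\<^bsub>m-1\<^esub>\<close>, and with respect to \<open>y\<close> one has
  \<open>V\<^bsub>m\<^esub>' = V\<^bsub>m\<^esub> - V\<^bsub>m-1\<^esub>\<close>. Hence \<open>R\<^bsub>m\<^esub>\<close> solves the Riccati equation
  \<open>y R' = m R\<^sup>2 + (y - m + 1/2) R - y\<close>. All its solutions other than \<open>R\<^bsub>m\<^esub>\<close> are driven away
  from \<open>R\<^bsub>m\<^esub>\<close> as \<open>y \<rightarrow> \<infinity>\<close>, so \<open>R\<^bsub>m\<^esub>\<close> stays below every strict subsolution, and above every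
  strict supersolution, with values between \<open>0\<close> and \<open>1\<close> on the whole half-line
  (\<open>K_compare\<close>). This principle is applied to the linear pair \<open>V\<^bsub>m\<^esub>, V\<^bsub>m-1\<^esub>\<close> rather than to
  the quotient: the difference \<open>e\<^bsup>-y\<^esup> (V\<^bsub>m\<^esub> - g V\<^bsub>m-1\<^esub>)\<close> tends to \<open>0\<close> and would have to increase
  as soon as it is nonnegative.

  The function \<open>G k p\<close> is \<open>1 / (1 + h)\<close>, where \<open>h\<close> is the positive root of
  \<open>k y h\<^sup>2 + 2 h (y + p) = 1\<close>. This relation is linear in \<open>y\<close>, so \<open>h\<close> serves as a parameter in
  which the Riccati residual becomes a rational function. For \<open>k = 4, p = m\<close> and for
  \<open>k = 8, p = m - 1\<close> it has a definite sign (\<open>residual_upper\<close>, \<open>residual_lower\<close>), which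
  proves the two bounds.

  For optimality no expansion of \<open>R\<^bsub>m\<^esub>\<close> is needed, because the two bounds agree with each other up
  to order \<open>y\<^bsup>-2\<^esup>\<close>. In that order \<open>G k m\<close> falls below the lower bound when \<open>k < 4\<close>, and
  \<open>G k (m - 1)\<close> rises above the upper bound when \<open>k > 8\<close>, for large \<open>y\<close>.
\<close>

section \<open>The bounding functions\<close>

text \<open>
  The excess of \<open>1 / G k p y\<close> over its limit \<open>1\<close>. The offset \<open>p\<close> is real, so that it can
  stand for both \<open>m\<close> and \<open>m - 1\<close> with \<open>m\<close> a natural number.
\<close>

definition excess :: "real \<Rightarrow> real \<Rightarrow> real \<Rightarrow> real" where
  "excess k p y = (sqrt ((y + p)\<^sup>2 + k * y) - (y + p)) / (k * y)"

lemma excess_pos: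
  assumes "k > 0" "y > 0"
  shows "excess k p y > 0"
proof -
  have "\<bar>y + p\<bar> < sqrt ((y + p)\<^sup>2 + k * y)"
    using assms by (intro real_less_rsqrt) auto
  then show ?thesis using assms by (simp add: excess_def)
qed

lemma G_eq_excess:
  assumes "k > 0" "y > 0"
  shows "G k p y = 1 / (1 + excess k (of_int p) y)"
proof -
  have "1 + excess k (of_int p) y =
      ((k - 1) * y - of_int p + sqrt ((y + of_int p)\<^sup>2 + k * y)) / (k * y)"
    using assms by (simp add: excess_def field_simps)
  then show ?thesis by (simp add: G_def)
qed

lemma excess_quadratic:
  assumes "k > 0" "y > 0"
  shows "k * y * (excess k p y)\<^sup>2 + 2 * excess k p y * (y + p) = 1"
proof -
  define s where "s = sqrt ((y + p)\<^sup>2 + k * y)"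
  have s2: "s\<^sup>2 = (y + p)\<^sup>2 + k * y" using assms by (simp add: s_def)
  have kh: "k * y * excess k p y = s - (y + p)" using assms by (simp add: excess_def s_def)
  have "k * y * (k * y * (excess k p y)\<^sup>2 + 2 * excess k p y * (y + p))
      = (k * y * excess k p y) * (k * y * excess k p y + 2 * (y + p))"
    by (simp add: power2_eq_square algebra_simps)
  also have "\<dots> = k * y * 1"
    unfolding kh using s2 by (simp add: power2_eq_square algebra_simps)
  finally show ?thesis using assms by (metis mult_cancel_left mult_pos_pos less_irrefl)
qed

text \<open>
  The quadratic expression of \<open>excess_quadratic\<close> crosses the value \<open>1\<close> only once on the positive
  half-line, so that inserting \<open>h\<close> locates it relative to the root.
\<close>

lemma excess_compare:
  assumes "k > 0" "y > 0" "h > 0"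
  shows "h < excess k p y \<longleftrightarrow> k * y * h\<^sup>2 + 2 * h * (y + p) < 1"
    and "excess k p y < h \<longleftrightarrow> 1 < k * y * h\<^sup>2 + 2 * h * (y + p)"
proof -
  define g where "g = excess k p y"
  define q where "q = k * y * h\<^sup>2 + 2 * h * (y + p)"
  define C where "C = 1 + k * y * g * h"
  have g: "g > 0" "k * y * g\<^sup>2 + 2 * g * (y + p) = 1"
    using excess_pos[of k y p] excess_quadratic[of k y p] assms by (auto simp: g_def)
  have "C > 0" using assms g by (simp add: C_def add_pos_pos)
  \<comment> \<open>The cross combination of the two values removes the linear terms and leaves a factor \<open>g - h\<close>.\<close>
  have "h * (k * y * g\<^sup>2 + 2 * g * (y + p)) - g * q = (k * y * g * h) * (g - h)"
    unfolding q_def by (simp add: power2_eq_square algebra_simps)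
  then have e: "g * (1 - q) = C * (g - h)"
    unfolding g(2) by (simp add: C_def algebra_simps)
  have "0 < g * (1 - q) \<longleftrightarrow> h < g" "g * (1 - q) < 0 \<longleftrightarrow> g < h"
    using \<open>C > 0\<close> by (simp_all add: e zero_less_mult_iff mult_less_0_iff)
  moreover have "0 < g * (1 - q) \<longleftrightarrow> q < 1" "g * (1 - q) < 0 \<longleftrightarrow> 1 < q"
    using g by (simp_all add: zero_less_mult_iff mult_less_0_iff)
  ultimately have "h < g \<longleftrightarrow> q < 1" "g < h \<longleftrightarrow> 1 < q" by simp_all
  then show "h < excess k p y \<longleftrightarrow> k * y * h\<^sup>2 + 2 * h * (y + p) < 1"
    and "excess k p y < h \<longleftrightarrow> 1 < k * y * h\<^sup>2 + 2 * h * (y + p)"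
    by (simp_all add: g_def q_def)
qed

text \<open>
  The derivative is given as a rational function of \<open>y\<close> and the excess itself, in the form that
  implicit differentiation of the quadratic equation yields; \<open>k y h + y + p\<close> is the square root
  in the definition.
\<close>

lemma excess_has_derivative:
  assumes "k > 0" "y > 0"
  shows "(excess k p has_real_derivative
           - excess k p y * (k * excess k p y + 2) / (2 * (k * y * excess k p y + y + p))) (at y)"
proof -
  define s where "s = sqrt ((y + p)\<^sup>2 + k * y)"
  have "(y + p)\<^sup>2 + k * y > 0" using assms by (simp add: add_nonneg_pos)
  then have s: "s > 0" "s\<^sup>2 = (y + p)\<^sup>2 + k * y" by (auto simp: s_def)
  have h: "excess k p y = (s - (y + p)) / (k * y)" by (simp add: excess_def s_def)
  have d: "(excess k p has_real_derivative
      (((2 * (y + p) + k) / (2 * s) - 1) * (k * y) - (s - (y + p)) * k) / (k * y)\<^sup>2) (at y)"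
    unfolding excess_def s_def using assms \<open>(y + p)\<^sup>2 + k * y > 0\<close>
    by (auto intro!: derivative_eq_intros simp: field_simps power2_eq_square)
  have sk: "k * y * excess k p y + y + p = s" using assms by (simp add: h)
  have "(((2 * (y + p) + k) / (2 * s) - 1) * (k * y) - (s - (y + p)) * k) / (k * y)\<^sup>2
     = - excess k p y * (k * excess k p y + 2) / (2 * s)"
  proof -
    have "((2 * (y + p) + k) - 2 * s) * (k * y) - 2 * s * (s - (y + p)) * k
        = - (s - (y + p)) * (k * (s - (y + p)) + 2 * (k * y))"
      using s(2) by algebra
    then show ?thesis using assms s unfolding h
      by (simp add: divide_simps power2_eq_square) algebra
  qed
  with d sk show ?thesis by simp
qed

lemma excess_tendsto:
  assumes "k > 0"
  shows "((\<lambda>y. y * excess k p y) \<longlongrightarrow> 1 / 2) at_top"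
proof -
  have "((\<lambda>y. sqrt ((y + p)\<^sup>2 + k * y) - (y + p)) \<longlongrightarrow> k / 2) at_top"
    by (real_asymp simp: field_simps)
  then have "((\<lambda>y. (sqrt ((y + p)\<^sup>2 + k * y) - (y + p)) / k) \<longlongrightarrow> k / 2 / k) at_top"
    by (intro tendsto_divide tendsto_const) (use assms in auto)
  moreover have "\<forall>\<^sub>F y in at_top. (sqrt ((y + p)\<^sup>2 + k * y) - (y + p)) / k = y * excess k p y"
    using eventually_gt_at_top[of 0] by eventually_elim (simp add: excess_def)
  ultimately show ?thesis using assms by (auto elim: Lim_transform_eventually)
qed

section \<open>Signs of the Riccati residuals\<close>

text \<open>
  For \<open>g = 1 / (1 + h)\<close> the Riccati residual \<open>m g\<^sup>2 + (y - m + 1/2) g - y - y g'\<close>, multiplied by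
  \<open>(1 + h)\<^sup>2\<close>, is \<open>y h' - y (h + h\<^sup>2) - m h + (1 + h) / 2\<close>. In the next two lemmas \<open>h'\<close> is
  the expression of \<open>excess_has_derivative\<close>. Eliminating \<open>y\<close> through the quadratic equation
  leaves a quotient with positive denominator whose numerator has a definite sign.
\<close>

lemma residual_upper:
  fixes h y m :: real
  assumes "h > 0" "y > 0" "m \<ge> 0" and q: "4 * y * h\<^sup>2 + 2 * h * (y + m) = 1"
  shows "0 < y * (- h * (4 * h + 2) / (2 * (4 * y * h + y + m))) - y * (h + h\<^sup>2) - m * h + (1 + h) / 2"
    (is "0 < ?E")
proof -
  define a Q where "a = 1 - 2 * h * m" and "Q = 1 + 4 * h - 4 * m * h\<^sup>2"
  define d where "d = h * (4 * h + 2)"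
  have "d > 0" using assms by (simp add: d_def add_pos_pos)
  have a: "y * d = a" using q by (simp add: a_def d_def power2_eq_square algebra_simps)
  then have y: "y = a / d" using \<open>d > 0\<close> by (simp add: field_simps)
  have "(4 * y * h + y + m) * d = Q + (4 * h + 1) * (y * d - a)"
    unfolding a_def Q_def d_def by (simp add: power2_eq_square algebra_simps)
  then have s: "(4 * y * h + y + m) * d = Q" using a by simp
  have "4 * y * h + y + m > 0" using assms by (simp add: add_pos_nonneg)
  then have "Q > 0" using s \<open>d > 0\<close> by (metis mult_pos_pos)
  have s': "4 * y * h + y + m = Q / d" using s \<open>d > 0\<close> by (simp add: field_simps)
  have "2 * h + 1 > 0" using assms by simp
  have 1: "y * (- h * (4 * h + 2) / (2 * (4 * y * h + y + m))) = - a * d / (2 * Q)"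
    unfolding s' using a \<open>d > 0\<close> by (simp add: d_def[symmetric] a[symmetric])
  have 2: "y * (h + h\<^sup>2) = a * (1 + h) / (2 * (2 * h + 1))"
    unfolding y d_def using assms(1) \<open>2 * h + 1 > 0\<close>
    by (simp add: divide_simps power2_eq_square) algebra
  have "?E = h * (h + m * h + 4 * m * h^3 + 4 * m\<^sup>2 * h^3) / (Q * (2 * h + 1))"
    unfolding 1 2 using \<open>Q > 0\<close> \<open>2 * h + 1 > 0\<close>
    by (simp add: divide_simps) (simp add: a_def Q_def d_def, algebra)
  also have "\<dots> > 0"
    using assms \<open>Q > 0\<close> \<open>2 * h + 1 > 0\<close> by (intro divide_pos_pos mult_pos_pos add_pos_nonneg) auto
  finally show ?thesis .
qed

text \<open>
  The numerator is not a sum of terms of one sign here: the negative contributions are absorbed by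
  means of \<open>1 - 2 h p > 0\<close>, which the quadratic equation implies.
\<close>

lemma residual_lower:
  fixes h y p :: real
  assumes "h > 0" "y > 0" and p: "p = -1 \<or> p \<ge> 0" and q: "8 * y * h\<^sup>2 + 2 * h * (y + p) = 1"
  shows "y * (- h * (8 * h + 2) / (2 * (8 * y * h + y + p))) - y * (h + h\<^sup>2) - (p + 1) * h + (1 + h) / 2 < 0"
    (is "?E < 0")
proof -
  define a Q where "a = 1 - 2 * h * p" and "Q = 1 + 8 * h - 8 * p * h\<^sup>2"
  define d where "d = h * (8 * h + 2)"
  have "d > 0" using assms by (simp add: d_def add_pos_pos)
  have a: "y * d = a" using q by (simp add: a_def d_def power2_eq_square algebra_simps)
  then have y: "y = a / d" using \<open>d > 0\<close> by (simp add: field_simps)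
  have "a > 0" using a \<open>d > 0\<close> assms by (metis mult_pos_pos)
  have "(8 * y * h + y + p) * d = Q + (8 * h + 1) * (y * d - a)"
    unfolding a_def Q_def d_def by (simp add: power2_eq_square algebra_simps)
  then have s: "(8 * y * h + y + p) * d = Q" using a by simp
  have "Q = (1 + 4 * h) * a + 4 * h + 2 * h * p"
    unfolding a_def Q_def by (simp add: power2_eq_square algebra_simps)
  moreover have "4 * h + 2 * h * p > 0" using p assms by (auto simp: add_pos_nonneg)
  moreover have "(1 + 4 * h) * a > 0" using \<open>a > 0\<close> assms by (simp add: add_pos_pos)
  ultimately have "Q > 0" by linarith
  have s': "8 * y * h + y + p = Q / d" using s \<open>d > 0\<close> by (simp add: field_simps)
  have "4 * h + 1 > 0" using assms by simp
  have 1: "y * (- h * (8 * h + 2) / (2 * (8 * y * h + y + p))) = - a * d / (2 * Q)"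
    unfolding s' using a \<open>d > 0\<close> by (simp add: d_def[symmetric] a[symmetric])
  have 2: "y * (h + h\<^sup>2) = a * (1 + h) / (2 * (4 * h + 1))"
    unfolding y d_def using assms(1) \<open>4 * h + 1 > 0\<close>
    by (simp add: divide_simps power2_eq_square) algebra
  define N where "N = 2 + 32 * h + p + 16 * p * h - 48 * p * h\<^sup>2 - 24 * p\<^sup>2 * h\<^sup>2"
  have "?E = - (h * (h * N) / (Q * (4 * h + 1)))"
    unfolding 1 2 using \<open>Q > 0\<close> \<open>4 * h + 1 > 0\<close>
    by (simp add: divide_simps) (simp add: a_def Q_def d_def N_def, algebra)
  moreover have "N > 0"
  proof -
    have "N = (2 + 8 * h + p + 4 * p * h) + (24 * h + 12 * p * h) * a"
      unfolding N_def a_def by (simp add: power2_eq_square algebra_simps)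
    moreover have "2 + 8 * h + p + 4 * p * h = (2 + p) * (1 + 4 * h)"
      "24 * h + 12 * p * h = (2 + p) * (12 * h)"
      by (simp_all add: algebra_simps)
    moreover have "2 + p > 0" using p by auto
    ultimately show ?thesis using \<open>a > 0\<close> assms by (simp add: add_pos_pos)
  qed
  ultimately show ?thesis using assms \<open>Q > 0\<close> \<open>4 * h + 1 > 0\<close> by simp
qed

section \<open>A comparison principle at infinity\<close>

text \<open>
  From a point where \<open>W\<close> is nonnegative it first climbs to a positive value. Since it decays to
  \<open>0\<close>, it attains a positive maximum further right, at a point where it would still have to
  increase.
\<close>

lemma negative_if_increasing_where_nonneg:
  fixes W W' :: "real \<Rightarrow> real"
  assumes deriv: "\<And>y. y > 0 \<Longrightarrow> (W has_real_derivative W' y) (at y)"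
    and pos: "\<And>y. y > 0 \<Longrightarrow> W y \<ge> 0 \<Longrightarrow> W' y > 0"
    and lim: "(W \<longlongrightarrow> 0) at_top" and "y > 0"
  shows "W y < 0"
proof (rule ccontr)
  assume "\<not> W y < 0"
  then have "W y \<ge> 0" by simp
  with DERIV_pos_inc_right[OF deriv[OF \<open>y > 0\<close>] pos[OF \<open>y > 0\<close>]]
  obtain d where d: "d > 0" "\<And>h. 0 < h \<Longrightarrow> h < d \<Longrightarrow> W y < W (y + h)" by blast
  define y1 where "y1 = y + d / 2"
  have y1: "y1 > y" "W y1 > 0" using d(1) d(2)[of "d / 2"] \<open>W y \<ge> 0\<close> by (auto simp: y1_def)
  have "\<forall>\<^sub>F t in at_top. W t < W y1 \<and> t > y1"
    using order_tendstoD(2)[OF lim y1(2)] eventually_gt_at_top[of y1] by eventually_elim auto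
  then obtain Y where Y: "W Y < W y1" "Y > y1" by (auto simp: eventually_at_top_linorder)
  have "continuous_on {y1..Y} W"
  proof (rule DERIV_atLeastAtMost_imp_continuous_on)
    fix t assume "y1 \<le> t"
    then show "\<exists>d. (W has_real_derivative d) (at t)" using deriv[of t] y1 \<open>y > 0\<close> by force
  qed
  then obtain z where z: "z \<in> {y1..Y}" "\<And>t. t \<in> {y1..Y} \<Longrightarrow> W t \<le> W z"
    using continuous_attains_sup[of "{y1..Y}" W] Y by auto
  have "W z \<ge> W y1" using z(2) Y by simp
  with Y have "z < Y" using z(1) by (metis atLeastAtMost_iff less_le_not_le order_le_less)
  have "z > 0" using z(1) y1 \<open>y > 0\<close> by simp
  with DERIV_pos_inc_right[OF deriv pos] \<open>W z \<ge> W y1\<close> y1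
  obtain e where e: "e > 0" "\<And>h. 0 < h \<Longrightarrow> h < e \<Longrightarrow> W z < W (z + h)" by force
  define h where "h = min (e / 2) (Y - z)"
  have "0 < h" "h < e" "z + h \<in> {y1..Y}"
    using e(1) \<open>z < Y\<close> z(1) by (auto simp: h_def min_def)
  with e(2)[of h] z(2)[of "z + h"] show False by simp
qed

section \<open>The integrals\<close>

lemma gamma_weight:
  shows gamma_weight_integrable: "set_integrable lborel {0<..} (\<lambda>u::real. u ^ m * exp (- u))"
    and gamma_weight_integral: "(LBINT u:{0<..}. (u::real) ^ m * exp (- u)) = fact m"
proof -
  have "((\<lambda>t::real. t powr (real (m + 1) - 1) / exp t) has_integral Gamma (real (m + 1))) {0..}"
    by (rule Gamma_integral_real) simp
  then have "((\<lambda>t::real. t powr (real (m + 1) - 1) / exp t) has_integral Gamma (real (m + 1))) {0<..}"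
    by (subst (asm) has_integral_spike_set_eq[where T = "{0<..}"])
       (auto intro: negligible_subset[of "{0}"])
  then have "((\<lambda>u::real. u ^ m * exp (- u)) has_integral Gamma (real (m + 1))) {0<..}"
    by (rule has_integral_eq[rotated]) (auto simp: powr_realpow exp_minus field_simps)
  then have hi: "((\<lambda>u::real. u ^ m * exp (- u)) has_integral fact m) {0<..}"
    using Gamma_fact[of m, where ?'a = real] by (simp add: add.commute)
  then have "(\<lambda>u::real. u ^ m * exp (- u)) absolutely_integrable_on {0<..}"
    by (intro nonnegative_absolutely_integrable_1) (auto simp: integrable_on_def)
  then show si: "set_integrable lborel {0<..} (\<lambda>u::real. u ^ m * exp (- u))"
    unfolding set_integrable_def by (subst (asm) integrable_completion) auto
  show "(LBINT u:{0<..}. (u::real) ^ m * exp (- u)) = fact m"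
    using set_borel_integral_eq_integral(2)[OF si] hi by (simp add: integral_unique)
qed

definition J :: "nat \<Rightarrow> real \<Rightarrow> real" where
  "J m y = (LBINT u:{0<..}. u ^ m * exp (- u) / sqrt (y + u))"

lemma J_integrable:
  assumes "y > 0"
  shows "set_integrable lborel {0<..} (\<lambda>u. u ^ m * exp (- u) / sqrt (y + u))"
proof (rule set_integrable_bound)
  show "set_integrable lborel {0<..} (\<lambda>u::real. (u ^ m * exp (- u)) / sqrt y)"
    using gamma_weight_integrable by (rule set_integrable_divide)
  show "set_borel_measurable lborel {0<..} (\<lambda>u. u ^ m * exp (- u) / sqrt (y + u))"
    unfolding set_borel_measurable_def by measurable
  show "AE u in lborel. u \<in> {0<..} \<longrightarrow> norm (u ^ m * exp (- u) / sqrt (y + u))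
      \<le> norm (u ^ m * exp (- u) / sqrt y)"
    using assms by (auto intro!: AE_I2 divide_left_mono)
qed

lemma J_le:
  assumes "y > 0"
  shows "J m y \<le> fact m / sqrt y"
proof -
  have "J m y \<le> (LBINT u:{0<..}. (u ^ m * exp (- u)) / sqrt y)"
    unfolding J_def
    using assms by (intro set_integral_mono J_integrable set_integrable_divide gamma_weight_integrable)
      (auto intro!: divide_left_mono)
  then show ?thesis by (simp add: gamma_weight_integral)
qed

lemma J_pos:
  assumes "y > 0"
  shows "J m y > 0"
proof -
  let ?f = "\<lambda>u. u ^ m * exp (- u) / sqrt (y + u)"
  have "J m y \<ge> 0"
    unfolding J_def set_lebesgue_integral_def using assms
    by (intro integral_nonneg_AE) (auto simp: indicator_def)
  moreover have "J m y \<noteq> 0"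
  proof
    assume "J m y = 0"
    then have "AE u in lborel. indicator {0<..} u *\<^sub>R ?f u = 0"
      using J_integrable[OF assms, of m] assms unfolding J_def set_lebesgue_integral_def set_integrable_def
      by (subst (asm) integral_nonneg_eq_0_iff_AE) (auto simp: indicator_def)
    then have "AE u in lborel. u \<notin> {0<..<1::real}"
      by eventually_elim (use assms in \<open>auto simp: indicator_def split: if_splits\<close>)
    then have "{0<..<1::real} \<in> null_sets lborel"
      by (subst AE_iff_null_sets) auto
    then have "emeasure lborel {0<..<1::real} = 0" by (rule null_setsD1)
    then show False by simp
  qed
  ultimately show ?thesis by simp
qed

text \<open>
  The integral over the derivative of \<open>u\<^sup>m e\<^bsup>-u\<^esup> sqrt (y + u)\<close> is the boundary value at \<open>0\<close>
  with a minus sign, and this value vanishes unless \<open>m = 0\<close>. For \<open>m = 0\<close> the truncated index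
  \<open>m - 1\<close> is harmless, as it comes with the factor \<open>m\<close>.
\<close>

lemma J_recurrence:
  assumes "y > 0"
  shows "J (Suc m) y = (real m + 1/2 - y) * J m y + real m * y * J (m - 1) y
    + (if m = 0 then sqrt y else 0)"
proof -
  define c :: real where c: "c = (if m = 0 then sqrt y else 0)"
  let ?w = "\<lambda>m u. u ^ m * exp (- u) / sqrt (y + u)"
  let ?f = "\<lambda>u. (real m + 1/2 - y) * ?w m u + real m * y * ?w (m - 1) u - ?w (Suc m) u"
  let ?F = "\<lambda>u. u ^ m * exp (- u) * sqrt (y + u)"
  have int: "set_integrable lborel {0<..} ?f"
    using assms by (intro set_integral_diff set_integral_add set_integrable_mult_right J_integrable) auto
  have "(LBINT u=0..\<infinity>. ?f u) = 0 - c"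
  proof (rule interval_integral_FTC_integrable)
    fix u :: real
    assume "0 < ereal u" "ereal u < \<infinity>"
    then have "u > 0" by simp
    have r: "sqrt (y + u) > 0" "sqrt (y + u) * sqrt (y + u) = y + u" using \<open>u > 0\<close> assms by auto
    have "(?F has_real_derivative
        (real m * u ^ (m - 1) * exp (- u) - u ^ m * exp (- u)) * sqrt (y + u)
         + u ^ m * exp (- u) * (1 / (2 * sqrt (y + u)))) (at u)"
      using \<open>u > 0\<close> assms by (auto intro!: derivative_eq_intros simp: field_simps)
    also have "(real m * u ^ (m - 1) * exp (- u) - u ^ m * exp (- u)) * sqrt (y + u)
         + u ^ m * exp (- u) * (1 / (2 * sqrt (y + u))) = ?f u"
    proof -
      have "(real m * a - b) * r + b * (1 / (2 * r))
          = (real m + 1/2 - y) * (b / r) + real m * y * (a / r) - u * b / r"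
        if "r > 0" "r * r = y + u" "real m * (u * a) = real m * b" for r a b
        using that(1) by (simp add: divide_simps) (use that(2,3) in algebra)
      from this[OF r, of "u ^ (m - 1) * exp (- u)" "u ^ m * exp (- u)"] show ?thesis
        by (cases m) (simp_all add: mult.assoc)
    qed
    finally show "(?F has_vector_derivative ?f u) (at u)"
      by (simp add: has_real_derivative_iff_has_vector_derivative)
    show "isCont ?f u" using \<open>u > 0\<close> assms by (intro continuous_intros) auto
  next
    show "set_integrable lborel (einterval 0 \<infinity>) ?f" using int by (simp add: zero_ereal_def)
    have "(?F \<longlongrightarrow> ?F 0) (at_right 0)"
      by (intro tendsto_intros)
    moreover have "?F 0 = c" using c by (cases m) auto
    ultimately show "((?F \<circ> real_of_ereal) \<longlongrightarrow> c) (at_right 0)"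
      unfolding zero_ereal_def ereal_tendsto_simps1 by simp
    have "((\<lambda>u. u ^ m * exp (- u) * sqrt (y + u)) \<longlongrightarrow> 0) at_top" by real_asymp
    then show "((?F \<circ> real_of_ereal) \<longlongrightarrow> 0) (at_left \<infinity>)"
      unfolding ereal_tendsto_simps1 .
  qed simp
  moreover have "(LBINT u=0..\<infinity>. ?f u)
      = (real m + 1/2 - y) * J m y + real m * y * J (m - 1) y - J (Suc m) y"
    unfolding zero_ereal_def interval_integral_to_infinity_eq J_def using assms
    by ((subst set_integral_diff(2) set_integral_add(2) set_integral_mult_right
        | (intro set_integral_add(1) set_integrable_mult_right J_integrable; simp; fail))+) simp
  ultimately show ?thesis unfolding c by simp
qed

text \<open>
  The substitution \<open>v = y + u\<close> moves the parameter into the limit of integration, where the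
  fundamental theorem of calculus applies; this avoids differentiation under the integral sign.
\<close>

lemma J0_has_derivative:
  assumes "y > 0"
  shows "(J 0 has_real_derivative J 0 y - 1 / sqrt y) (at y)"
proof -
  define f where "f = (\<lambda>v::real. exp (- v) / sqrt v)"
  define T where "T = (\<lambda>y. LBINT v:{y<..}. f v)"
  have shift: "(\<lambda>u. indicator {t<..} (t + 1 * u) *\<^sub>R f (t + 1 * u))
      = (\<lambda>u. exp (- t) * (indicator {0<..} u *\<^sub>R (u ^ 0 * exp (- u) / sqrt (t + u))))" for t
    by (auto simp: f_def indicator_def exp_add[symmetric] fun_eq_iff)
  have J: "J 0 t = exp t * T t" if "t > 0" for t
  proof -
    have "T t = (LBINT u. indicator {t<..} (t + 1 * u) *\<^sub>R f (t + 1 * u))"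
      unfolding T_def set_lebesgue_integral_def
      by (subst lborel_integral_real_affine[where c = 1 and t = t]) simp_all
    also have "\<dots> = exp (- t) * J 0 t"
      unfolding shift integral_mult_right_zero J_def set_lebesgue_integral_def ..
    finally have "T t = exp (- t) * J 0 t" .
    then show ?thesis by (simp add: exp_minus)
  qed
  have fint: "set_integrable lborel {t<..} f" if "t > 0" for t
  proof -
    have "integrable lborel (\<lambda>u. indicator {t<..} (t + 1 * u) *\<^sub>R f (t + 1 * u))"
      unfolding shift using J_integrable[OF that, of 0] unfolding set_integrable_def
      by (intro integrable_mult_right) auto
    then show ?thesis unfolding set_integrable_def
      by (subst (asm) lborel_integrable_real_affine_iff) auto
  qed
  \<comment> \<open>The base point stays away from \<open>0\<close>, where the integrand is singular.\<close>
  define a where "a = y / 2"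
  have a: "0 < a" "a < y" using assms by (auto simp: a_def)
  have T: "T t = T a - integral {a..t} f" if "t \<in> {a<..}" for t
  proof -
    have t: "a < t" using that by simp
    have *: "set_integrable lborel {a<..t} f" "set_integrable lborel {t<..} f"
      using fint[OF a(1)] by (rule set_integrable_subset; use t in auto)+
    have "{a<..} = {a<..t} \<union> {t<..}" using t by auto
    then have "T a = (LBINT v:{a<..t}. f v) + T t"
      unfolding T_def by (metis * set_integral_Un[of "{a<..t}" "{t<..}" lborel f] Int_emptyI
        greaterThanAtMost_iff greaterThan_iff not_le)
    also have "(LBINT v:{a<..t}. f v) = integral {a<..t} f"
      using *(1) by (rule set_borel_integral_eq_integral)
    also have "\<dots> = integral {a..t} f"
      by (rule integral_subset_negligible) (auto intro: negligible_subset[of "{a}"])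
    finally show ?thesis by simp
  qed
  have "((\<lambda>t. integral {a..t} f) has_real_derivative f y) (at y within {a..y+1})"
    using a by (intro integral_has_real_derivative) (auto simp: f_def intro!: continuous_intros)
  then have "((\<lambda>t. integral {a..t} f) has_real_derivative f y) (at y)"
    using a by (simp add: at_within_interior[of y "{a..y+1}"])
  then have "((\<lambda>t. exp t * (T a - integral {a..t} f)) has_real_derivative
      exp y * (T a - integral {a..y} f) - exp y * f y) (at y)"
    by (auto intro!: derivative_eq_intros)
  then have "(J 0 has_real_derivative exp y * (T a - integral {a..y} f) - exp y * f y) (at y)"
    by (rule has_field_derivative_transform_within_open[of _ _ _ "{a<..}"]) (use a J T in auto)
  moreover have "exp y * (T a - integral {a..y} f) - exp y * f y = J 0 y - 1 / sqrt y"
    using T[of y] J[of y] a assms by (simp add: f_def exp_minus)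
  ultimately show ?thesis by simp
qed

section \<open>The functions V as solutions of a linear system\<close>

text \<open>
  The function \<open>V\<close> in the variable \<open>y = x\<^sup>2\<close>. The shift of the index makes the special value
  \<open>V (-1)\<close> the start of an induction over natural numbers.
\<close>

definition K :: "nat \<Rightarrow> real \<Rightarrow> real" where
  "K m y = V (real m - 1) (sqrt y)"

lemma K_0: "K 0 y = 1 / sqrt y"
  by (simp add: K_def V_def)

lemma K_Suc:
  assumes "y > 0"
  shows "K (Suc m) y = J m y / fact m"
proof -
  have "(LBINT u:{0<..}. u powr real m * exp (- u) / sqrt ((sqrt y)\<^sup>2 + u)) = J m y"
    unfolding J_def using assms by (intro set_lebesgue_integral_cong) (auto simp: powr_realpow)
  moreover have "Gamma (real m + 1) = fact m" using Gamma_fact[of m, where ?'a = real] by (simp add: add.commute)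
  ultimately show ?thesis by (simp add: K_def V_def)
qed

lemma R_eq_K:
  assumes "x > 0"
  shows "R m x = K (Suc m) (x\<^sup>2) / K m (x\<^sup>2)"
  using assms by (simp add: R_def K_def)

lemma K_pos: "y > 0 \<Longrightarrow> K m y > 0"
  by (cases m) (auto simp: K_0 K_Suc J_pos)

lemma K_le: "y > 0 \<Longrightarrow> K m y \<le> 1 / sqrt y"
  using J_le[of y "m - 1"] by (cases m) (auto simp: K_0 K_Suc field_simps)

lemma K_tendsto: "(K m \<longlongrightarrow> 0) at_top"
proof (rule tendsto_sandwich[of "\<lambda>_. 0" _ _ "\<lambda>y. 1 / sqrt y"])
  show "\<forall>\<^sub>F y in at_top. 0 \<le> K m y" "\<forall>\<^sub>F y in at_top. K m y \<le> 1 / sqrt y"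
    using eventually_gt_at_top[of "0::real"]
    by (eventually_elim, simp add: K_pos less_imp_le K_le)+
qed (simp, real_asymp)

lemma K_recurrence:
  assumes "y > 0"
  shows "real (Suc m) * K (Suc (Suc m)) y = (real m + 1/2 - y) * K (Suc m) y + y * K m y"
proof (cases m)
  case 0
  then show ?thesis using assms J_recurrence[OF assms, of 0] by (simp add: K_0 K_Suc real_div_sqrt)
next
  case (Suc n)
  have "real (Suc m) * K (Suc (Suc m)) y = J (Suc m) y / fact m"
    using assms by (simp add: K_Suc del: of_nat_Suc)
  also have "\<dots> = (real m + 1/2 - y) * (J m y / fact m) + y * (real m * J n y / fact m)"
    unfolding J_recurrence[OF assms, of m] by (simp add: Suc add_divide_distrib mult_ac)
  also have "real m * J n y / fact m = J n y / fact n"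
    unfolding Suc by (simp del: of_nat_Suc)
  finally show ?thesis using assms Suc by (simp add: K_Suc)
qed

text \<open>
  Both derivatives are established by one induction. The recurrence turns the second one for \<open>m\<close>
  into the first one for \<open>m + 1\<close>, and differentiating the recurrence gives the second one for
  \<open>m + 1\<close>. Thus only the integral of index \<open>0\<close> has to be differentiated as an integral.
\<close>

lemma K_has_derivative:
  assumes "y > 0"
  shows "(K m has_real_derivative ((real m - 1/2) * K m y - real m * K (Suc m) y) / y) (at y)"
    and "(K (Suc m) has_real_derivative K (Suc m) y - K m y) (at y)"
  using assms
proof (induction m arbitrary: y)
  case 0
  {
    case 1
    have "sqrt y * sqrt y = y" using 1 by simp
    then show ?case using 1 unfolding K_0
      by (auto intro!: derivative_eq_intros simp: divide_simps power2_eq_square)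
  next
    case 2
    show ?case
      by (rule has_field_derivative_transform_within_open[of "J 0" _ _ "{0<..}"])
         (use 2 J0_has_derivative in \<open>auto simp: K_0 K_Suc\<close>)
  }
next
  case (Suc m)
  {
    case 1
    have "K (Suc m) y - K m y
        = ((real (Suc m) - 1/2) * K (Suc m) y - real (Suc m) * K (Suc (Suc m)) y) / y"
      unfolding K_recurrence[OF 1] using 1 by (simp add: field_simps)
    with Suc.IH(2)[OF 1] show ?case by simp
  next
    case 2
    let ?r = "\<lambda>t. ((real m + 1/2 - t) * K (Suc m) t + t * K m t) / real (Suc m)"
    have "(?r has_real_derivative
        ((- K (Suc m) y + (real m + 1/2 - y) * (K (Suc m) y - K m y))
          + (K m y + y * (((real m - 1/2) * K m y - real m * K (Suc m) y) / y))) / real (Suc m)) (at y)"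
      using Suc.IH[OF 2] by (auto intro!: derivative_eq_intros)
    also have "((- K (Suc m) y + (real m + 1/2 - y) * (K (Suc m) y - K m y))
          + (K m y + y * (((real m - 1/2) * K m y - real m * K (Suc m) y) / y))) / real (Suc m)
        = ((real m + 1/2 - y) * K (Suc m) y + y * K m y - real (Suc m) * K (Suc m) y) / real (Suc m)"
    proof -
      have "y * (X / y) = X" for X using 2 by simp
      then show ?thesis by (simp add: algebra_simps del: times_divide_eq_right)
    qed
    also have "\<dots> = K (Suc (Suc m)) y - K (Suc m) y"
      unfolding K_recurrence[OF 2, symmetric] diff_divide_distrib by (simp del: of_nat_Suc)
    finally show ?case
      by (rule has_field_derivative_transform_within_open[of _ _ _ "{0<..}"])
         (use 2 K_recurrence in \<open>auto simp: field_simps\<close>)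
  }
qed

text \<open>
  The sign \<open>c\<close> treats upper and lower bounds at once: for \<open>c = 1\<close> the function \<open>g\<close> is a strict
  subsolution of the Riccati equation and bounds the quotient \<open>K (Suc m) y / K m y\<close> from above,
  for \<open>c = -1\<close> it is a strict supersolution and a lower bound.
\<close>

lemma K_compare:
  fixes c :: real and g g' :: "real \<Rightarrow> real"
  assumes c: "\<bar>c\<bar> = 1"
    and g: "\<And>y. y > 0 \<Longrightarrow> 0 < g y" "\<And>y. y > 0 \<Longrightarrow> g y \<le> 1"
    and deriv: "\<And>y. y > 0 \<Longrightarrow> (g has_real_derivative g' y) (at y)"
    and res: "\<And>y. y > 0 \<Longrightarrow>
      0 < c * (real m * (g y)\<^sup>2 + (y - real m + 1/2) * g y - y - y * g' y)"
    and "y > 0"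
  shows "c * K (Suc m) y < c * (g y * K m y)"
proof -
  define D where "D = (\<lambda>y. c * (K (Suc m) y - g y * K m y))"
  \<comment> \<open>The derivative of \<open>D\<close> is \<open>(1 + m g / y) D\<close> plus a multiple of the residual; the exponential
      cancels the summand \<open>D\<close>, and the remaining coefficient is nonnegative.\<close>
  define W where "W = (\<lambda>y. exp (- y) * D y)"
  define r where "r = (\<lambda>y. c * (real m * (g y)\<^sup>2 + (y - real m + 1/2) * g y - y - y * g' y))"
  have "W y < 0"
  proof (rule negative_if_increasing_where_nonneg[where W = W and
        W' = "\<lambda>y. exp (- y) * (real m * g y * D y + r y * K m y) / y"])
    fix y :: real assume "y > 0"
    show "(W has_real_derivative exp (- y) * (real m * g y * D y + r y * K m y) / y) (at y)"
      unfolding W_def D_def r_def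
      by (rule derivative_eq_intros deriv[OF \<open>y > 0\<close>] K_has_derivative[OF \<open>y > 0\<close>] refl)+
         (use \<open>y > 0\<close> in \<open>simp add: field_simps power2_eq_square\<close>)
    assume "W y \<ge> 0"
    then have "D y \<ge> 0" by (simp add: W_def zero_le_mult_iff)
    then have "real m * g y * D y \<ge> 0" using g(1)[OF \<open>y > 0\<close>] by simp
    moreover have "r y * K m y > 0" using res[OF \<open>y > 0\<close>] K_pos[OF \<open>y > 0\<close>] by (simp add: r_def)
    ultimately show "exp (- y) * (real m * g y * D y + r y * K m y) / y > 0"
      using \<open>y > 0\<close> by (simp add: add_nonneg_pos)
  next
    have "((\<lambda>y. K (Suc m) y + K m y) \<longlongrightarrow> 0) at_top"
      using tendsto_add[OF K_tendsto K_tendsto, of "Suc m" m] by simp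
    then show "(W \<longlongrightarrow> 0) at_top"
    proof (rule Lim_null_comparison[rotated])
      show "\<forall>\<^sub>F y in at_top. norm (W y) \<le> K (Suc m) y + K m y"
        using eventually_gt_at_top[of 0]
      proof eventually_elim
        case (elim y)
        have "\<bar>D y\<bar> = \<bar>K (Suc m) y - g y * K m y\<bar>" using c by (simp add: D_def abs_mult)
        also have "\<dots> \<le> K (Suc m) y + 1 * K m y"
          using K_pos[OF elim, of m] K_pos[OF elim, of "Suc m"] g[OF elim] mult_right_mono[OF g(2)[OF elim], of "K m y"]
          by (smt (verit) mult_pos_pos)
        finally have "\<bar>D y\<bar> \<le> K (Suc m) y + K m y" by simp
        moreover have "\<bar>W y\<bar> \<le> 1 * \<bar>D y\<bar>"
          unfolding W_def abs_mult using elim by (intro mult_right_mono) auto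
        ultimately show ?case by simp
      qed
    qed
  qed fact
  then have "D y < 0" by (simp add: W_def mult_less_0_iff)
  then show ?thesis by (simp add: D_def algebra_simps)
qed

lemma K_compare_excess:
  fixes c k p :: real
  assumes c: "\<bar>c\<bar> = 1" and "k > 0"
    and res: "\<And>y. y > 0 \<Longrightarrow> 0 < c * (y * (- excess k p y * (k * excess k p y + 2) / (2 * (k * y * excess k p y + y + p)))
        - y * (excess k p y + (excess k p y)\<^sup>2) - real m * excess k p y + (1 + excess k p y) / 2)"
    and "y > 0"
  shows "c * (K (Suc m) y / K m y) < c * (1 / (1 + excess k p y))"
proof -
  define h' where "h' = (\<lambda>y. - excess k p y * (k * excess k p y + 2) / (2 * (k * y * excess k p y + y + p)))"
  have "c * K (Suc m) y < c * (1 / (1 + excess k p y) * K m y)"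
  proof (rule K_compare[where g' = "\<lambda>y. - h' y / (1 + excess k p y)\<^sup>2"])
    fix y :: real assume y: "y > 0"
    have h: "excess k p y > 0" using excess_pos y \<open>k > 0\<close> by blast
    show "0 < 1 / (1 + excess k p y)" "1 / (1 + excess k p y) \<le> 1" using h by auto
    show "((\<lambda>y. 1 / (1 + excess k p y)) has_real_derivative - h' y / (1 + excess k p y)\<^sup>2) (at y)"
      unfolding h'_def using h
      by (auto intro!: derivative_eq_intros excess_has_derivative[OF \<open>k > 0\<close> y] simp: power2_eq_square)
    have id: "real m * (1 / b)\<^sup>2 + (y - real m + 1/2) * (1 / b) - y - y * (- d / b\<^sup>2)
        = (y * d - y * ((b - 1) + (b - 1)\<^sup>2) - real m * (b - 1) + b / 2) / b\<^sup>2"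
      if "b > 0" for b d
      using that by (simp add: divide_simps power2_eq_square) algebra
    have "0 < c * (y * h' y - y * (excess k p y + (excess k p y)\<^sup>2) - real m * excess k p y + (1 + excess k p y) / 2)
        / (1 + excess k p y)\<^sup>2"
      using res[OF y] h unfolding h'_def by (intro divide_pos_pos) auto
    then show "0 < c * (real m * (1 / (1 + excess k p y))\<^sup>2 + (y - real m + 1/2) * (1 / (1 + excess k p y))
        - y - y * (- h' y / (1 + excess k p y)\<^sup>2))"
      using h by (subst id) auto
  qed fact+
  then show ?thesis using K_pos[OF \<open>y > 0\<close>, of m] by (simp add: field_simps)
qed

section \<open>The two bounds\<close>

theorem R_less_G4:
  assumes "x > 0"
  shows "R m x < G 4 (int m) (x\<^sup>2)"
proof -
  have "1 * (K (Suc m) (x\<^sup>2) / K m (x\<^sup>2)) < 1 * (1 / (1 + excess 4 (real m) (x\<^sup>2)))"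
  proof (rule K_compare_excess)
    fix y :: real assume "y > 0"
    then show "0 < 1 * (y * (- excess 4 (real m) y * (4 * excess 4 (real m) y + 2) / (2 * (4 * y * excess 4 (real m) y + y + real m)))
        - y * (excess 4 (real m) y + (excess 4 (real m) y)\<^sup>2) - real m * excess 4 (real m) y + (1 + excess 4 (real m) y) / 2)"
      using residual_upper[of "excess 4 (real m) y" y "real m"] excess_pos[of 4 y] excess_quadratic[of 4 y "real m"] by simp
  qed (use assms in auto)
  then show ?thesis using assms by (simp add: R_eq_K G_eq_excess)
qed

theorem G8_less_R:
  assumes "x > 0"
  shows "G 8 (int m - 1) (x\<^sup>2) < R m x"
proof -
  define p where "p = real m - 1"
  have p: "p = -1 \<or> p \<ge> 0" "real m = p + 1" by (cases m; auto simp: p_def)+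
  have "-1 * (K (Suc m) (x\<^sup>2) / K m (x\<^sup>2)) < -1 * (1 / (1 + excess 8 p (x\<^sup>2)))"
  proof (rule K_compare_excess)
    fix y :: real assume "y > 0"
    then show "0 < -1 * (y * (- excess 8 p y * (8 * excess 8 p y + 2) / (2 * (8 * y * excess 8 p y + y + p)))
        - y * (excess 8 p y + (excess 8 p y)\<^sup>2) - real m * excess 8 p y + (1 + excess 8 p y) / 2)"
      unfolding p(2) mult_minus1 neg_0_less_iff_less
      by (intro residual_lower excess_pos excess_quadratic p) simp_all
  qed (use assms in auto)
  then show ?thesis using assms by (simp add: R_eq_K G_eq_excess p_def)
qed

section \<open>Optimality of the constants\<close>

text \<open>
  Inserting the excess \<open>h\<close> for \<open>8\<close> and \<open>p - 1\<close> into the quadratic for \<open>k\<close> and \<open>p\<close> changes its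
  value \<open>1\<close> by \<open>h (2 - (8 - k) y h)\<close>. As \<open>y h\<close> tends to \<open>1/2\<close>, the bracket tends to
  \<open>(k - 4) / 2\<close>: this is where the constant \<open>4\<close> comes from.
\<close>

lemma eventually_excess8_less_excess:
  assumes "0 < k" "k < 4"
  shows "\<forall>\<^sub>F y in at_top. excess 8 (p - 1) y < excess k p y"
proof -
  have "((\<lambda>y. 2 - (8 - k) * (y * excess 8 (p - 1) y)) \<longlongrightarrow> 2 - (8 - k) * (1 / 2)) at_top"
    by (intro tendsto_intros excess_tendsto) auto
  then have "\<forall>\<^sub>F y in at_top. 2 - (8 - k) * (y * excess 8 (p - 1) y) < 0"
    by (rule order_tendstoD) (use assms in auto)
  then show ?thesis
    using eventually_gt_at_top[of 0]
  proof eventually_elim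
    case (elim y)
    define h where "h = excess 8 (p - 1) y"
    have h: "h > 0" "8 * y * h\<^sup>2 + 2 * h * (y + (p - 1)) = 1"
      using elim excess_pos[of 8 y] excess_quadratic[of 8 y "p - 1"] by (auto simp: h_def)
    have "k * y * h\<^sup>2 + 2 * h * (y + p)
        = (8 * y * h\<^sup>2 + 2 * h * (y + (p - 1))) + h * (2 - (8 - k) * (y * h))"
      by (simp add: power2_eq_square algebra_simps)
    also have "\<dots> < 1" using h elim by (simp add: mult_pos_neg h_def[symmetric])
    finally show ?case using excess_compare(1)[of k y h p] assms h elim by (simp add: h_def)
  qed
qed

text \<open>
  The same computation with the excess \<open>h\<close> for \<open>4\<close> and \<open>p\<close> changes the value \<open>1\<close> by
  \<open>h ((k - 4) y h - 2)\<close>, and the bracket tends to \<open>(k - 8) / 2\<close>.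
\<close>

lemma eventually_excess_less_excess4:
  assumes "8 < k"
  shows "\<forall>\<^sub>F y in at_top. excess k (p - 1) y < excess 4 p y"
proof -
  have "((\<lambda>y. (k - 4) * (y * excess 4 p y) - 2) \<longlongrightarrow> (k - 4) * (1 / 2) - 2) at_top"
    by (intro tendsto_intros excess_tendsto) auto
  then have "\<forall>\<^sub>F y in at_top. (k - 4) * (y * excess 4 p y) - 2 > 0"
    by (rule order_tendstoD) (use assms in auto)
  then show ?thesis
    using eventually_gt_at_top[of 0]
  proof eventually_elim
    case (elim y)
    define h where "h = excess 4 p y"
    have h: "h > 0" "4 * y * h\<^sup>2 + 2 * h * (y + p) = 1"
      using elim excess_pos[of 4 y] excess_quadratic[of 4 y p] by (auto simp: h_def)
    have "k * y * h\<^sup>2 + 2 * h * (y + (p - 1))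
        = (4 * y * h\<^sup>2 + 2 * h * (y + p)) + h * ((k - 4) * (y * h) - 2)"
      by (simp add: power2_eq_square algebra_simps)
    also have "\<dots> > 1" using h elim by (simp add: h_def[symmetric])
    finally show ?case using excess_compare(2)[of k y h "p - 1"] assms h elim by (simp add: h_def)
  qed
qed

lemma G_less_iff:
  assumes "k > 0" "l > 0" "y > 0"
  shows "G k p y < G l q y \<longleftrightarrow> excess l (of_int q) y < excess k (of_int p) y"
  using assms excess_pos[of k y "of_int p"] excess_pos[of l y "of_int q"] by (simp add: G_eq_excess field_simps)

text \<open>
  A smaller \<open>k\<close> would put the upper bound below the proved lower bound at some large argument.
\<close>

lemma upper_bound_fails:
  assumes "0 < k" "k < 4"
  shows "\<exists>x>0. \<not> R m x < G k (int m) (x\<^sup>2)"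
proof -
  have "\<forall>\<^sub>F y in at_top. excess 8 (real m - 1) y < excess k (real m) y \<and> y > 0"
    using eventually_excess8_less_excess[OF assms] eventually_gt_at_top[of 0] by (rule eventually_conj)
  then obtain y where y: "excess 8 (real m - 1) y < excess k (real m) y" "y > 0"
    by (auto simp: eventually_at_top_linorder)
  then have "G k (int m) y < G 8 (int m - 1) y" using assms by (simp add: G_less_iff)
  also have "\<dots> < R m (sqrt y)" using G8_less_R[of "sqrt y" m] y by simp
  finally show ?thesis using y by (intro exI[of _ "sqrt y"]) auto
qed

text \<open>
  A larger \<open>k\<close> would put the lower bound above the proved upper bound at some large argument.
\<close>

lemma lower_bound_fails:
  assumes "8 < k"
  shows "\<exists>x>0. \<not> G k (int m - 1) (x\<^sup>2) < R m x"
proof -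
  have "\<forall>\<^sub>F y in at_top. excess k (real m - 1) y < excess 4 (real m) y \<and> y > 0"
    using eventually_excess_less_excess4[OF assms] eventually_gt_at_top[of 0] by (rule eventually_conj)
  then obtain y where y: "excess k (real m - 1) y < excess 4 (real m) y" "y > 0"
    by (auto simp: eventually_at_top_linorder)
  have "R m (sqrt y) < G 4 (int m) y" using R_less_G4[of "sqrt y" m] y by simp
  also have "\<dots> < G k (int m - 1) y" using assms y by (simp add: G_less_iff)
  finally show ?thesis using y by (intro exI[of _ "sqrt y"]) auto
qed

theorem theorem21:
  shows "(\<forall>(m::nat) (x::real). x > 0 \<longrightarrow>
            G 8 (int m - 1) (x\<^sup>2) < R m x \<and> R m x < G 4 (int m) (x\<^sup>2))
    \<and> (\<forall>(m::nat) (k::real). 0 < k \<and> k < 4 \<longrightarrow>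
            \<not> (\<forall>x::real. x > 0 \<longrightarrow> R m x < G k (int m) (x\<^sup>2)))
    \<and> (let S = {k::int. k > 0 \<and>
            (\<forall>(m::nat) (x::real). x > 0 \<longrightarrow> G (of_int k) (int m - 1) (x\<^sup>2) < R m x)}
       in 8 \<in> S \<and> (\<forall>k\<in>S. k \<le> 8))"
proof -
  have "k \<le> 8" if k: "\<forall>(m::nat) (x::real). x > 0 \<longrightarrow> G (of_int k) (int m - 1) (x\<^sup>2) < R m x"
    for k :: int
  proof (rule ccontr)
    assume "\<not> k \<le> 8"
    then have "(of_int k :: real) > 8" by simp
    with k lower_bound_fails[of "of_int k" 0] show False by blast
  qed
  moreover have "\<not> (\<forall>x::real. x > 0 \<longrightarrow> R m x < G k (int m) (x\<^sup>2))"
    if "0 < k" "k < 4" for m k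
    using upper_bound_fails[OF that, of m] by blast
  ultimately show ?thesis
    using R_less_G4 G8_less_R by (simp add: Let_def)
qed

end
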